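(* The variance of the main-lobe RFI brightness temperature $T_{(ml)}$ is $$\mathrm{Var}[T_{(ml)}]=40^2\,g_{(ml)}^2\,\omega^{2}\,\lambda_c\,p_{2}(\lambda_{BS})\,d_{(ml)}^{-2\alpha},$$ where $p_2(\lambda_{BS})=(2b_0)^2(\lambda_{BS}^2+2\lambda_{BS})$ under Rayleigh fading, and, writing $\kappa=\frac{2b_0m+\Omega}{2b_0m}$, $$p_2(\lambda_{BS})=(2b_0)^2\left(\lambda_{BS}^2\left(m\kappa-m+1\right)^2+\lambda_{BS}\left(m(m+1)\kappa^2-2m(m-1)\kappa+(m-1)(m-2)\right)\right)$$ under shadowed Rician fading.
   Context: Constants $\omega>0$, $\alpha>2$, $\lambda_c>0$ (cluster intensity per km$^2$), $\lambda_{BS}>0$, $g_{(ml)}>0$, Earth radius $r_e>0$ and satellite distance to the Earth's center $h>r_e$ are given. $d_{(ml)}$ is the positive root $d$ of $d^2+2d\,r_e\cos(40^\circ)+r_e^2-h^2=0$. The main-lobe footprint has area $40^2$ km$^2$ and contains $M\sim\mathrm{Pois}(40^2\lambda_c)$ clusters, all at distance $d_{(ml)}$ from the satellite. $T_{(ml)}=\sum_{i=1}^{M}\sum_{j=1}^{N_i}g_{(ml)}\omega|H_{ij}|^2d_{(ml)}^{-\alpha}$, with $N_i\sim\mathrm{Pois}(\lambda_{BS})$ i.i.d., channel power gains $|H_{ij}|^2$ i.i.d., and all of $M$, $N_i$, $|H_{ij}|^2$ independent. Rayleigh fading: $|H|^2$ is exponential with mean $2b_0$. Shadowed Rician fading with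 parameters $(\Omega,2b_0,m)$, $b_0,m,\Omega>0$: $|H|^2$ has density $\frac{1}{2b_0}\left(\frac{2b_0m}{2b_0m+\Omega}\right)^m e^{-t/(2b_0)}\,{}_1F_1\left(m;1;\frac{\Omega t}{2b_0(2b_0m+\Omega)}\right)$ on $t>0$. *)

theory Defs
  imports "HOL-Probability.Probability"
begin

text \<open>
  The angle is 40 degrees. For \<open>0 < r\<^sub>e < h\<close> the positive root exists and is unique (see below).
\<close>

definition d_ml :: "real \<Rightarrow> real \<Rightarrow> real" where
  "d_ml r\<^sub>e h = (THE d. d > 0 \<and> d\<^sup>2 + 2 * d * r\<^sub>e * cos (40 * pi / 180) + r\<^sub>e\<^sup>2 - h\<^sup>2 = 0)"

lemma d_ml_unique:
  assumes "0 < r\<^sub>e" "r\<^sub>e < h"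
  shows "\<exists>!d. d > 0 \<and> d\<^sup>2 + 2 * d * r\<^sub>e * cos (40 * pi / 180) + r\<^sub>e\<^sup>2 - h\<^sup>2 = 0"
proof -
  define b where "b = r\<^sub>e * cos (40 * pi / 180)"
  have "cos (40 * pi / 180) > 0"
    using pi_gt_zero by (intro cos_gt_zero) simp_all
  then have b: "b > 0"
    using assms by (simp add: b_def)
  have c: "h\<^sup>2 - r\<^sub>e\<^sup>2 > 0"
    using assms by (simp add: power_strict_mono)
  define s where "s = sqrt (b\<^sup>2 + (h\<^sup>2 - r\<^sub>e\<^sup>2))"
  have s2: "s\<^sup>2 = b\<^sup>2 + (h\<^sup>2 - r\<^sub>e\<^sup>2)"
    using c by (simp add: s_def)
  have sb: "s > b"
    unfolding s_def using b c by (intro real_less_rsqrt) simp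
  have eq: "d\<^sup>2 + 2 * d * r\<^sub>e * cos (40 * pi / 180) + r\<^sub>e\<^sup>2 - h\<^sup>2 = (d + b - s) * (d + b + s)" for d
  proof -
    have "(d + b - s) * (d + b + s) = d\<^sup>2 + 2 * d * b + b\<^sup>2 - s\<^sup>2"
      by (simp add: algebra_simps power2_eq_square)
    then show ?thesis
      by (simp add: s2 b_def)
  qed
  show ?thesis
    unfolding eq
  proof (rule ex1I[of _ "s - b"])
    show "s - b > 0 \<and> (s - b + b - s) * (s - b + b + s) = 0"
      using sb by simp
    show "d = s - b" if "d > 0 \<and> (d + b - s) * (d + b + s) = 0" for d
      using that b sb by auto
  qed
qed

lemma d_ml:
  assumes "0 < r\<^sub>e" "r\<^sub>e < h"
  shows "d_ml r\<^sub>e h > 0"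
    and "(d_ml r\<^sub>e h)\<^sup>2 + 2 * d_ml r\<^sub>e h * r\<^sub>e * cos (40 * pi / 180) + r\<^sub>e\<^sup>2 - h\<^sup>2 = 0"
  using theI'[OF d_ml_unique[OF assms]] unfolding d_ml_def by blast+

text \<open>
  Clusters, and base stations within a cluster, are numbered from 0: \<open>K\<close> is the number of
  clusters, \<open>N i\<close> the number of base stations in cluster \<open>i\<close>, \<open>H i j\<close> the channel coefficient.
\<close>

definition T_ml ::
  "real \<Rightarrow> real \<Rightarrow> real \<Rightarrow> real \<Rightarrow> ('a \<Rightarrow> nat) \<Rightarrow> (nat \<Rightarrow> 'a \<Rightarrow> nat) \<Rightarrow> (nat \<Rightarrow> nat \<Rightarrow> 'a \<Rightarrow> complex) \<Rightarrow> 'a \<Rightarrow> real"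
where
  "T_ml g \<omega> \<alpha> d K N H x = (\<Sum>i<K x. \<Sum>j<N i x. g * \<omega> * (cmod (H i j x))\<^sup>2 * d powr (- \<alpha>))"

text \<open>
  The cluster count, the per-cluster base station counts and the channel power gains form
  one family, so that their mutual independence can be stated with \<open>indep_vars\<close>.
  The counts are embedded into the reals because \<open>indep_vars\<close> needs a common value type;
  the sigma-algebra generated by a count is not affected.
\<close>

datatype rv_index = Cluster_count | BS_count nat | Power_gain nat nat

primrec rfi_rv ::
  "('a \<Rightarrow> nat) \<Rightarrow> (nat \<Rightarrow> 'a \<Rightarrow> nat) \<Rightarrow> (nat \<Rightarrow> nat \<Rightarrow> 'a \<Rightarrow> complex) \<Rightarrow> rv_index \<Rightarrow> 'a \<Rightarrow> real"
where
  "rfi_rv K N H Cluster_count = (\<lambda>x. real (K x))"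
| "rfi_rv K N H (BS_count i) = (\<lambda>x. real (N i x))"
| "rfi_rv K N H (Power_gain i j) = (\<lambda>x. (cmod (H i j x))\<^sup>2)"

definition poisson_distributed :: "'a measure \<Rightarrow> ('a \<Rightarrow> nat) \<Rightarrow> real \<Rightarrow> bool" where
  "poisson_distributed P X r \<longleftrightarrow>
     X \<in> measurable P (count_space UNIV) \<and>
     distr P (count_space UNIV) X = measure_pmf (poisson_pmf r)"

definition hyp1F1 :: "real \<Rightarrow> real \<Rightarrow> real \<Rightarrow> real" where
  "hyp1F1 a b z = (\<Sum>n. pochhammer a n / (pochhammer b n * fact n) * z ^ n)"

definition shadowed_rician_density :: "real \<Rightarrow> real \<Rightarrow> real \<Rightarrow> real \<Rightarrow> real" where
  "shadowed_rician_density \<Omega> b\<^sub>0 m t =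
     (if t > 0 then
        1 / (2 * b\<^sub>0) * (2 * b\<^sub>0 * m / (2 * b\<^sub>0 * m + \<Omega>)) powr m * exp (- t / (2 * b\<^sub>0))
        * hyp1F1 m 1 (\<Omega> * t / (2 * b\<^sub>0 * (2 * b\<^sub>0 * m + \<Omega>)))
      else 0)"

definition p2_rayleigh :: "real \<Rightarrow> real \<Rightarrow> real" where
  "p2_rayleigh b\<^sub>0 l = (2 * b\<^sub>0)\<^sup>2 * (l\<^sup>2 + 2 * l)"

definition p2_shadowed_rician :: "real \<Rightarrow> real \<Rightarrow> real \<Rightarrow> real \<Rightarrow> real" where
  "p2_shadowed_rician \<Omega> b\<^sub>0 m l =
     (let \<kappa> = (2 * b\<^sub>0 * m + \<Omega>) / (2 * b\<^sub>0 * m)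
      in (2 * b\<^sub>0)\<^sup>2 *
         (l\<^sup>2 * (m * \<kappa> - m + 1)\<^sup>2
          + l * (m * (m + 1) * \<kappa>\<^sup>2 - 2 * m * (m - 1) * \<kappa> + (m - 1) * (m - 2))))"

end

theory Submission
  imports Defs
begin

text \<open>
  The temperature is a constant times a random sum over clusters of random sums over base stations.
  Conditioning on the number of summands expresses the first two moments of a random sum by those
  of its summands and the factorial moments of the count (for a Poisson count of mean \<open>l\<close> these
  are \<open>l\<close> and \<open>l\<^sup>2\<close>); applying this at both levels reduces the claim to the first two moments of
  the channel gain. The shadowed Rician law is a mixture of Erlang laws of shape \<open>n + 1\<close> with
  negative binomial weights in \<open>n\<close> with parameter \<open>p = \<Omega> / (2 b\<^sub>0 m + \<Omega>)\<close>, for which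
  \<open>p / (1 - p) = \<kappa> - 1\<close>.
\<close>

section \<open>Moments of random sums\<close>

text \<open>Splits the space by the value of \<open>N\<close>. At each point only the term with
  \<open>n = N x\<close> survives, so the pointwise series is trivial, and absolute summability of
  the expectations permits integration term by term.\<close>

lemma (in prob_space) sums_expectation_indicator:
  fixes N :: "'a \<Rightarrow> nat" and F :: "'a \<Rightarrow> real"
  assumes [measurable]: "N \<in> measurable M (count_space UNIV)"
    and int: "\<And>n. integrable M (\<lambda>x. indicator {n} (N x) * F x)"
    and summ: "summable (\<lambda>n. expectation (\<lambda>x. \<bar>indicator {n} (N x) * F x\<bar>))"
  shows "integrable M F"
    and "(\<lambda>n. expectation (\<lambda>x. indicator {n} (N x) * F x)) sums expectation F"
proof -
  have single: "(\<lambda>n. indicator {n} (N x) * F x) sums F x" for x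
    using sums_single[of "N x" "\<lambda>_. F x"]
    by (rule sums_cong[THEN iffD1, rotated]) (auto simp: indicator_def)
  have abs_summable: "summable (\<lambda>n. norm (indicator {n} (N x) * F x))" for x
    using sums_single[of "N x" "\<lambda>_. \<bar>F x\<bar>"]
    by (intro sums_summable[where l="\<bar>F x\<bar>"], elim sums_cong[THEN iffD1, rotated])
      (auto simp: indicator_def)
  have F: "F = (\<lambda>x. \<Sum>n. indicator {n} (N x) * F x)"
    using single by (auto simp: sums_iff)
  show "integrable M F"
    by (subst F, rule integrable_suminf) (use int abs_summable summ in auto)
  show "(\<lambda>n. expectation (\<lambda>x. indicator {n} (N x) * F x)) sums expectation F"
    by (subst (2) F, rule sums_integral) (use int abs_summable summ in auto)
qed

text \<open>Where the count equals \<open>n\<close>, the square of the sum has n diagonal products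
  and n(n - 1) mixed ones, and independence factors each expectation; hence the factorial moments
  \<open>a\<close> and \<open>b\<close>. In the index type \<open>None\<close> is the count and
  \<open>Some j\<close> the j-th summand. The conclusions on moments have the shape of the
  hypotheses on \<open>X\<close>, so the lemma can be applied to its own output.\<close>

lemma (in prob_space) random_sum_moments:
  fixes N :: "'a \<Rightarrow> nat" and X :: "nat \<Rightarrow> 'a \<Rightarrow> real" and \<mu> s a b :: real
  defines "S \<equiv> \<lambda>x. \<Sum>j<N x. X j x"
  assumes indep: "indep_vars (\<lambda>_. borel) (case_option (\<lambda>x. real (N x)) X) UNIV"
    and X2: "\<And>j. integrable M (\<lambda>x. (X j x)\<^sup>2)"
    and \<mu>: "\<And>j. expectation (X j) = \<mu>"
    and s: "\<And>j. expectation (\<lambda>x. (X j x)\<^sup>2) = s"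
    and a: "(\<lambda>n. real n * prob {x \<in> space M. N x = n}) sums a"
    and b: "(\<lambda>n. real n * (real n - 1) * prob {x \<in> space M. N x = n}) sums b"
  shows "integrable M S"
    and "integrable M (\<lambda>x. (S x)\<^sup>2)"
    and "expectation S = a * \<mu>"
    and "expectation (\<lambda>x. (S x)\<^sup>2) = a * s + b * \<mu>\<^sup>2"
proof -
  have rv: "random_variable borel (case_option (\<lambda>x. real (N x)) X k)" for k
    using indep by (auto simp: indep_vars_def)
  have [measurable]: "X j \<in> borel_measurable M" for j
    using rv[of "Some j"] by simp
  have [measurable]: "(\<lambda>x. real (N x)) \<in> borel_measurable M"
    using rv[of None] by simp
  \<comment> \<open>The independent family contains the count only as a real variable; rounding down
    recovers \<open>N\<close>.\<close>
  have "(\<lambda>x. nat \<lfloor>real (N x)\<rfloor>) \<in> measurable M (count_space UNIV)"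
    by measurable
  then have N[measurable]: "N \<in> measurable M (count_space UNIV)"
    by simp
  define q where "q n = prob {x \<in> space M. N x = n}" for n
  define I where "I n x = indicat_real {n} (N x)" for n x
  have I[measurable]: "I n \<in> borel_measurable M" for n
    unfolding I_def by (rule measurable_compose[OF N]) simp
  have int_X: "integrable M (X j)" for j
    by (rule square_integrable_imp_integrable[OF _ X2]) auto
  have EI: "expectation (I n) = q n" for n
  proof -
    have "expectation (I n) = expectation (indicator {x \<in> space M. N x = n})"
      by (intro Bochner_Integration.integral_cong) (auto simp: I_def indicator_def)
    then show ?thesis
      by (simp add: q_def Int_absorb2)
  qed
  have int_I: "integrable M (I n)" for n
    by (rule integrable_const_bound[where B=1]) (auto simp: I_def indicator_def)
  \<comment> \<open>The event that the count equals \<open>n\<close> is a function of the count, so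
    its indicator can replace the count in the independent family.\<close>
  have ind': "indep_vars (\<lambda>_. borel) (case_option (I n) X) UNIV" for n
  proof -
    have "indep_vars (\<lambda>_. borel)
        (\<lambda>k x. (case k of None \<Rightarrow> indicat_real {real n} | Some _ \<Rightarrow> (\<lambda>y. y))
          (case_option (\<lambda>x. real (N x)) X k x)) UNIV"
      by (rule indep_vars_compose2[OF indep]) (auto split: option.split)
    also have "(\<lambda>k x. (case k of None \<Rightarrow> indicat_real {real n} | Some _ \<Rightarrow> (\<lambda>y. y))
          (case_option (\<lambda>x. real (N x)) X k x)) = case_option (I n) X"
      by (auto simp: fun_eq_iff I_def indicator_def split: option.split)
    finally show ?thesis .
  qed
  have one: "integrable M (\<lambda>x. I n x * X j x)"
    "expectation (\<lambda>x. I n x * X j x) = q n * \<mu>" for n j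
  proof -
    have *: "indep_vars (\<lambda>_. borel) (case_option (I n) X) {None, Some j}"
      by (rule indep_vars_subset[OF ind']) auto
    have i: "integrable M (case_option (I n) X k)" for k
      using int_I int_X by (cases k) auto
    show "integrable M (\<lambda>x. I n x * X j x)"
      using indep_vars_integrable[OF _ * i] by auto
    show "expectation (\<lambda>x. I n x * X j x) = q n * \<mu>"
      using indep_vars_lebesgue_integral[OF _ * i] by (auto simp: EI \<mu>)
  qed
  \<comment> \<open>Distinctness makes this a product over three different indices, to which the
    product rule applies.\<close>
  have two: "integrable M (\<lambda>x. I n x * (X j x * X k x))"
    "expectation (\<lambda>x. I n x * (X j x * X k x)) = q n * \<mu>\<^sup>2" if "j \<noteq> k" for n j k
  proof -
    have *: "indep_vars (\<lambda>_. borel) (case_option (I n) X) {None, Some j, Some k}"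
      by (rule indep_vars_subset[OF ind']) auto
    have i: "integrable M (case_option (I n) X k)" for k
      using int_I int_X by (cases k) auto
    show "integrable M (\<lambda>x. I n x * (X j x * X k x))"
      using indep_vars_integrable[OF _ * i] that by auto
    show "expectation (\<lambda>x. I n x * (X j x * X k x)) = q n * \<mu>\<^sup>2"
      using indep_vars_lebesgue_integral[OF _ * i] that
      by (auto simp: EI \<mu> power2_eq_square)
  qed
  \<comment> \<open>A repeated factor is first merged into a square, taken on the coordinate
    \<open>Some j\<close> of the family.\<close>
  have sq: "integrable M (\<lambda>x. I n x * (X j x * X j x))"
    "expectation (\<lambda>x. I n x * (X j x * X j x)) = q n * s" for n j
  proof -
    have *: "indep_vars (\<lambda>_. borel)
        (\<lambda>k x. (case k of None \<Rightarrow> (\<lambda>y. y) | Some _ \<Rightarrow> (\<lambda>y. y\<^sup>2)) (case_option (I n) X k x))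
        {None, Some j}"
      by (rule indep_vars_compose2[OF indep_vars_subset[OF ind']]) (auto split: option.split)
    have i: "integrable M
        (\<lambda>x. (case k of None \<Rightarrow> (\<lambda>y. y) | Some _ \<Rightarrow> (\<lambda>y. y\<^sup>2)) (case_option (I n) X k x))" for k
      using int_I X2 by (cases k) auto
    show "integrable M (\<lambda>x. I n x * (X j x * X j x))"
      using indep_vars_integrable[OF _ * i] by (auto simp: power2_eq_square)
    show "expectation (\<lambda>x. I n x * (X j x * X j x)) = q n * s"
      using indep_vars_lebesgue_integral[OF _ * i] s
      by (auto simp: EI power2_eq_square)
  qed
  have I_S: "I n x * S x = (\<Sum>j<n. I n x * X j x)" for n x
    by (auto simp: I_def S_def indicator_def sum_distrib_left)
  have I_S2: "I n x * (S x)\<^sup>2 = (\<Sum>j<n. \<Sum>k<n. I n x * (X j x * X k x))" for n x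
    by (cases "N x = n") (simp_all add: I_def S_def power2_eq_square sum_product)
  have cross: "integrable M (\<lambda>x. I n x * (X j x * X k x))"
    "expectation (\<lambda>x. I n x * (X j x * X k x)) = q n * (if j = k then s else \<mu>\<^sup>2)" for n j k
    using sq two by (cases "j = k"; simp)+
  have int_S: "integrable M (\<lambda>x. I n x * S x)" for n
    unfolding I_S using one by auto
  have int_S2: "integrable M (\<lambda>x. I n x * (S x)\<^sup>2)" for n
    unfolding I_S2 using cross by auto
  have E_S: "expectation (\<lambda>x. I n x * S x) = real n * q n * \<mu>" for n
    unfolding I_S using one by (simp add: Bochner_Integration.integral_sum)
  have E_S2: "expectation (\<lambda>x. I n x * (S x)\<^sup>2)
      = real n * q n * s + real n * (real n - 1) * q n * \<mu>\<^sup>2" for n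
  proof -
    \<comment> \<open>One diagonal entry and n - 1 mixed ones, computed as a constant row plus a
      correction at \<open>k = j\<close>.\<close>
    have row: "(\<Sum>k<n. q n * (if j = k then s else \<mu>\<^sup>2)) = q n * (s + (real n - 1) * \<mu>\<^sup>2)"
      if "j < n" for j
    proof -
      have "(\<Sum>k<n. q n * (if j = k then s else \<mu>\<^sup>2))
          = (\<Sum>k<n. q n * \<mu>\<^sup>2 + (if j = k then q n * (s - \<mu>\<^sup>2) else 0))"
        by (intro sum.cong) (auto simp: algebra_simps)
      then show ?thesis
        using that by (simp add: sum.distrib algebra_simps)
    qed
    have "expectation (\<lambda>x. I n x * (S x)\<^sup>2)
        = (\<Sum>j<n. \<Sum>k<n. q n * (if j = k then s else \<mu>\<^sup>2))"
      unfolding I_S2 using cross by (simp add: Bochner_Integration.integral_sum)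
    also have "\<dots> = (\<Sum>j<n. q n * (s + (real n - 1) * \<mu>\<^sup>2))"
      by (intro sum.cong) (simp_all only: row lessThan_iff)
    finally show ?thesis
      by (simp add: algebra_simps)
  qed
  have sums_S2: "(\<lambda>n. expectation (\<lambda>x. I n x * (S x)\<^sup>2)) sums (a * s + b * \<mu>\<^sup>2)"
    unfolding E_S2 using a b unfolding q_def by (intro sums_add sums_mult2)
  have abs_S2: "\<bar>I n x * (S x)\<^sup>2\<bar> = I n x * (S x)\<^sup>2" for n x
    by (simp add: I_def)
  have "summable (\<lambda>n. expectation (\<lambda>x. \<bar>I n x * (S x)\<^sup>2\<bar>))"
    unfolding abs_S2 using sums_S2 by (rule sums_summable)
  note S2 = sums_expectation_indicator[OF N, of "\<lambda>x. (S x)\<^sup>2", folded I_def, OF int_S2 this]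
  show "integrable M (\<lambda>x. (S x)\<^sup>2)"
    by (rule S2(1))
  show "expectation (\<lambda>x. (S x)\<^sup>2) = a * s + b * \<mu>\<^sup>2"
    using sums_S2 S2(2) by (rule sums_unique2[symmetric])
  \<comment> \<open>The sign of \<open>S\<close> is unknown, so absolute summability comes from the
    second moment through the bound of |S| by 1 + S^2.\<close>
  have "summable (\<lambda>n. expectation (\<lambda>x. \<bar>I n x * S x\<bar>))"
  proof (rule summable_comparison_test'[of _ 0])
    show "summable (\<lambda>n. q n + expectation (\<lambda>x. I n x * (S x)\<^sup>2))"
    proof (rule summable_add)
      \<comment> \<open>From n = 1 on, \<open>q n\<close> is at most n times \<open>q n\<close>, the
        general term of the series for \<open>a\<close>.\<close>
      show "summable q"
      proof (rule summable_comparison_test'[OF sums_summable[OF a], of 1])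
        show "norm (q n) \<le> real n * prob {x \<in> space M. N x = n}" if "1 \<le> n" for n
          using mult_right_mono[of 1 "real n" "q n"] that by (simp add: q_def)
      qed
      show "summable (\<lambda>n. expectation (\<lambda>x. I n x * (S x)\<^sup>2))"
        using sums_S2 by (rule sums_summable)
    qed
    fix n
    have "\<bar>I n x * S x\<bar> \<le> I n x + I n x * (S x)\<^sup>2" for x
    proof -
      have "0 \<le> (\<bar>S x\<bar> - 1)\<^sup>2"
        by simp
      then have "2 * \<bar>S x\<bar> \<le> 1 + (S x)\<^sup>2"
        by (simp add: power2_eq_square algebra_simps abs_mult_self_eq)
      then have "\<bar>S x\<bar> \<le> 1 + (S x)\<^sup>2"
        by (smt (verit) abs_ge_zero)
      then show ?thesis
        by (simp add: I_def indicator_def)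
    qed
    then have "expectation (\<lambda>x. \<bar>I n x * S x\<bar>) \<le> expectation (\<lambda>x. I n x + I n x * (S x)\<^sup>2)"
      using int_S int_S2 int_I by (intro integral_mono) auto
    then show "norm (expectation (\<lambda>x. \<bar>I n x * S x\<bar>)) \<le> q n + expectation (\<lambda>x. I n x * (S x)\<^sup>2)"
      using int_S2 int_I by (simp add: EI Bochner_Integration.integral_add)
  qed
  note S1 = sums_expectation_indicator[OF N, of S, folded I_def, OF int_S this]
  show "integrable M S"
    by (rule S1(1))
  have "(\<lambda>n. expectation (\<lambda>x. I n x * S x)) sums (a * \<mu>)"
    unfolding E_S using a unfolding q_def by (intro sums_mult2)
  then show "expectation S = a * \<mu>"
    using S1(2) by (rule sums_unique2[symmetric])
qed

section \<open>Factorial moments of the Poisson law\<close>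

text \<open>The weights of the first two factorial moments cancel the leading factors of the
  factorial, which turns a moment series into a shifted base series. The spare factor
  \<open>y\<close> holds the exponential in the Poisson case and the power of \<open>p\<close> in
  the negative binomial case.\<close>

lemma Suc_mult_div_fact_Suc:
  fixes x y :: real
  shows "real (Suc n) * (x / fact (Suc n) * y) = x / fact n * y"
    and "real (Suc (Suc n)) * (real (Suc (Suc n)) - 1) * (x / fact (Suc (Suc n)) * y) = x / fact n * y"
proof -
  show *: "real (Suc n) * (x / fact (Suc n) * y) = x / fact n * y" for n x y
    by (simp add: fact_Suc del: of_nat_Suc)
  have "real (Suc (Suc n)) * (real (Suc (Suc n)) - 1) * (x / fact (Suc (Suc n)) * y)
      = real (Suc n) * (real (Suc (Suc n)) * (x / fact (Suc (Suc n)) * y))"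
    by simp
  then show "real (Suc (Suc n)) * (real (Suc (Suc n)) - 1) * (x / fact (Suc (Suc n)) * y)
      = x / fact n * y"
    by (simp only: *)
qed

lemma sums_exp_Poisson:
  fixes l :: real
  shows "(\<lambda>n. real n * (l ^ n / fact n * exp (- l))) sums l"
    and "(\<lambda>n. real n * (real n - 1) * (l ^ n / fact n * exp (- l))) sums l\<^sup>2"
proof -
  have base: "(\<lambda>n. c * (l ^ n / fact n * exp (- l))) sums c" for c
  proof -
    have "(\<lambda>n. c * (l ^ n / fact n * exp (- l))) sums (c * (exp l * exp (- l)))"
      using exp_converges[of l] by (intro sums_mult sums_mult2) (simp add: divide_inverse mult.commute)
    then show ?thesis
      by (simp add: exp_minus)
  qed
  have "(\<lambda>n. real (Suc n) * (l ^ Suc n / fact (Suc n) * exp (- l))) sums l"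
    unfolding Suc_mult_div_fact_Suc using base[of l] by (simp add: mult.assoc)
  then show "(\<lambda>n. real n * (l ^ n / fact n * exp (- l))) sums l"
    by (subst (asm) sums_Suc_iff) simp
  have "(\<lambda>n. real (Suc (Suc n)) * (real (Suc (Suc n)) - 1)
      * (l ^ Suc (Suc n) / fact (Suc (Suc n)) * exp (- l))) sums l\<^sup>2"
    unfolding Suc_mult_div_fact_Suc using base[of "l\<^sup>2"]
    by (simp add: power2_eq_square mult.assoc)
  \<comment> \<open>The shift by two is undone one index at a time; the terms restored, at n = 1 and
    then at n = 0, vanish.\<close>
  then have "(\<lambda>n. real (Suc n) * (real (Suc n) - 1)
      * (l ^ Suc n / fact (Suc n) * exp (- l))) sums l\<^sup>2"
    by (subst (asm) sums_Suc_iff) simp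
  then show "(\<lambda>n. real n * (real n - 1) * (l ^ n / fact n * exp (- l))) sums l\<^sup>2"
    by (subst (asm) sums_Suc_iff) simp
qed

lemma poisson_distributed_prob:
  assumes "poisson_distributed P X l" "0 < l"
  shows "measure P {x \<in> space P. X x = n} = l ^ n / fact n * exp (- l)"
proof -
  have X: "X \<in> measurable P (count_space UNIV)"
    and d: "distr P (count_space UNIV) X = measure_pmf (poisson_pmf l)"
    using assms(1) by (auto simp: poisson_distributed_def)
  have "measure P {x \<in> space P. X x = n} = measure (distr P (count_space UNIV) X) {n}"
    by (subst measure_distr[OF X]) (auto intro!: arg_cong[where f="measure P"])
  also have "\<dots> = pmf (poisson_pmf l) n"
    by (simp add: d measure_pmf_single)
  finally show ?thesis
    using assms(2) by simp
qed

lemma poisson_distributed_sums: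
  assumes "poisson_distributed P X l" "0 < l"
  shows "(\<lambda>n. real n * measure P {x \<in> space P. X x = n}) sums l"
    and "(\<lambda>n. real n * (real n - 1) * measure P {x \<in> space P. X x = n}) sums l\<^sup>2"
  unfolding poisson_distributed_prob[OF assms] by (fact sums_exp_Poisson)+

section \<open>Negative binomial series\<close>

text \<open>The first series is the binomial series of (1 - p)^(-m). Pulling the first factors out
  of the Pochhammer symbol reduces the other two to the same series with m + 1 and m + 2 in place of
  m.\<close>

lemma sums_pochhammer:
  fixes m p :: real
  assumes "\<bar>p\<bar> < 1"
  shows "(\<lambda>n. pochhammer m n / fact n * p ^ n) sums (1 - p) powr (- m)"
    and "(\<lambda>n. real n * (pochhammer m n / fact n * p ^ n)) sums (m * p * (1 - p) powr (- m - 1))"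
    and "(\<lambda>n. real n * (real n - 1) * (pochhammer m n / fact n * p ^ n))
      sums (m * (m + 1) * p\<^sup>2 * (1 - p) powr (- m - 2))"
proof -
  have base: "(\<lambda>n. pochhammer m n / fact n * p ^ n) sums (1 - p) powr (- m)" for m :: real
  proof -
    have "(- m gchoose n) * (- p) ^ n = pochhammer m n / fact n * p ^ n" for n
    proof -
      have "(- 1) ^ n * (- 1) ^ n = (1 :: real)"
        by (simp flip: power_add)
      then show ?thesis
        by (simp add: gbinomial_pochhammer power_minus[of p])
    qed
    then show ?thesis
      using gen_binomial_real[of "- p" "- m"] assms by simp
  qed
  then show "(\<lambda>n. pochhammer m n / fact n * p ^ n) sums (1 - p) powr (- m)" .
  have "(\<lambda>n. m * p * (pochhammer (m + 1) n / fact n * p ^ n)) sums (m * p * (1 - p) powr (- m - 1))"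
    using base[of "m + 1"] by (intro sums_mult) simp
  then have "(\<lambda>n. real (Suc n) * (pochhammer m (Suc n) / fact (Suc n) * p ^ Suc n))
      sums (m * p * (1 - p) powr (- m - 1))"
    unfolding Suc_mult_div_fact_Suc by (simp add: pochhammer_rec mult_ac)
  then show "(\<lambda>n. real n * (pochhammer m n / fact n * p ^ n)) sums (m * p * (1 - p) powr (- m - 1))"
    by (subst (asm) sums_Suc_iff) simp
  have "(\<lambda>n. m * (m + 1) * p\<^sup>2 * (pochhammer (m + 1 + 1) n / fact n * p ^ n))
      sums (m * (m + 1) * p\<^sup>2 * (1 - p) powr (- m - 2))"
    using base[of "m + 1 + 1"] by (intro sums_mult) (simp add: algebra_simps)
  then have "(\<lambda>n. real (Suc (Suc n)) * (real (Suc (Suc n)) - 1)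
      * (pochhammer m (Suc (Suc n)) / fact (Suc (Suc n)) * p ^ Suc (Suc n)))
      sums (m * (m + 1) * p\<^sup>2 * (1 - p) powr (- m - 2))"
    unfolding Suc_mult_div_fact_Suc by (simp add: pochhammer_rec power2_eq_square mult_ac)
  then have "(\<lambda>n. real (Suc n) * (real (Suc n) - 1)
      * (pochhammer m (Suc n) / fact (Suc n) * p ^ Suc n))
      sums (m * (m + 1) * p\<^sup>2 * (1 - p) powr (- m - 2))"
    by (subst (asm) sums_Suc_iff) simp
  then show "(\<lambda>n. real n * (real n - 1) * (pochhammer m n / fact n * p ^ n))
      sums (m * (m + 1) * p\<^sup>2 * (1 - p) powr (- m - 2))"
    by (subst (asm) sums_Suc_iff) simp
qed


text \<open>\<open>w\<close> is the negative binomial law: (1 - p)^m normalises the binomial series,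
  and the leftover negative powers of 1 - p combine with p into p / (1 - p).\<close>

lemma negative_binomial_sums:
  fixes m p :: real
  assumes "0 \<le> p" "p < 1"
  defines "w \<equiv> \<lambda>n. (1 - p) powr m * (pochhammer m n / fact n * p ^ n)"
  shows "w sums 1"
    and "(\<lambda>n. real n * w n) sums (m * (p / (1 - p)))"
    and "(\<lambda>n. real n * (real n - 1) * w n) sums (m * (m + 1) * (p / (1 - p))\<^sup>2)"
proof -
  have p: "\<bar>p\<bar> < 1"
    using assms by simp
  have split: "(1 - p) powr (- m - 1) = (1 - p) powr (- m) / (1 - p)"
    "(1 - p) powr (- m - 2) = (1 - p) powr (- m) / (1 - p)\<^sup>2"
    using assms by (simp_all add: powr_diff)
  have cancel: "(1 - p) powr m * (1 - p) powr (- m) = 1"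
    using assms by (simp flip: powr_add)
  have cancel': "(1 - p) powr m * (c * ((1 - p) powr (- m) / d)) = c / d" for c d
  proof -
    have "(1 - p) powr m * (c * ((1 - p) powr (- m) / d))
        = (1 - p) powr m * (1 - p) powr (- m) * (c / d)"
      by simp
    then show ?thesis
      by (simp only: cancel mult_1)
  qed
  show "w sums 1"
    unfolding w_def using sums_mult[OF sums_pochhammer(1)[OF p], of "(1 - p) powr m" m]
    by (simp only: cancel)
  show "(\<lambda>n. real n * w n) sums (m * (p / (1 - p)))"
    unfolding w_def using sums_mult[OF sums_pochhammer(2)[OF p], of "(1 - p) powr m" m]
    unfolding split cancel' by (simp add: mult_ac)
  show "(\<lambda>n. real n * (real n - 1) * w n) sums (m * (m + 1) * (p / (1 - p))\<^sup>2)"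
    unfolding w_def using sums_mult[OF sums_pochhammer(3)[OF p], of "(1 - p) powr m" m]
    unfolding split cancel' by (simp add: mult_ac power_divide)
qed

section \<open>The shadowed Rician law as an Erlang mixture\<close>

lemma summable_hyp1F1_1:
  fixes m z :: real
  shows "summable (\<lambda>n. pochhammer m n / (pochhammer 1 n * fact n) * z ^ n)"
proof -
  \<comment> \<open>Split the general term as a null sequence times the exponential series of \<open>2 z\<close>.\<close>
  have "(\<lambda>n. pochhammer m n / fact n * (1 / 2) ^ n) \<longlonglongrightarrow> 0"
    by (intro summable_LIMSEQ_zero sums_summable[OF sums_pochhammer(1)]) simp
  then have "Bseq (\<lambda>n. pochhammer m n / fact n * (1 / 2) ^ n)"
    by (intro convergent_imp_Bseq convergentI)
  then obtain C where C: "\<And>n. norm (pochhammer m n / fact n * (1 / 2) ^ n) \<le> C"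
    unfolding Bseq_def by blast
  have "summable (\<lambda>n. C * norm (inverse (fact n) * (2 * z) ^ n))"
    using summable_norm_exp[of "2 * z"] by (intro summable_mult) simp
  then show ?thesis
  proof (rule summable_comparison_test'[of _ 0])
    fix n
    have "pochhammer m n / (pochhammer 1 n * fact n) * z ^ n
        = (pochhammer m n / fact n * (1 / 2) ^ n) * (inverse (fact n) * (2 * z) ^ n)"
      by (simp add: field_simps flip: pochhammer_fact)
    then show "norm (pochhammer m n / (pochhammer 1 n * fact n) * z ^ n)
        \<le> C * norm (inverse (fact n) * (2 * z) ^ n)"
      using mult_right_mono[OF C[of n] norm_ge_zero[of "inverse (fact n) * (2 * z) ^ n"]]
      by (simp only: norm_mult)
  qed
qed

text \<open>Expands the confluent hypergeometric function. As \<open>pochhammer 1 n\<close> is n!,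
  the denominator has two factorials: one goes to the negative binomial weight, the other to the
  Erlang density of shape n + 1 and rate 1 / (2b).\<close>

lemma shadowed_rician_density_sums:
  fixes \<Omega> b m t :: real
  assumes pos: "\<Omega> > 0" "b > 0" "m > 0"
    and "t \<noteq> 0" \<comment> \<open>at 0 the Erlang density of shape 1 is positive, but the other side is 0 by convention\<close>
  defines "p \<equiv> \<Omega> / (2 * b * m + \<Omega>)"
  shows "(\<lambda>n. (1 - p) powr m * (pochhammer m n / fact n * p ^ n) * erlang_density n (1 / (2 * b)) t)
    sums shadowed_rician_density \<Omega> b m t"
proof (cases "t > 0")
  case False
  then show ?thesis
    using assms by (simp add: erlang_density_def shadowed_rician_density_def)
next
  case True
  have bm: "2 * b * m + \<Omega> > 0"
    using pos by (simp add: add_pos_pos)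
  then have q: "2 * b * m / (2 * b * m + \<Omega>) = 1 - p"
    by (simp add: p_def field_simps)
  have z: "\<Omega> * t / (2 * b * (2 * b * m + \<Omega>)) = p * (t / (2 * b))"
    using bm pos by (simp add: p_def)
  define c where "c = 1 / (2 * b) * (1 - p) powr m * exp (- t / (2 * b))"
  have "(\<lambda>n. c * (pochhammer m n / (pochhammer 1 n * fact n) * (p * (t / (2 * b))) ^ n))
      sums (c * hyp1F1 m 1 (p * (t / (2 * b))))"
    unfolding hyp1F1_def by (intro sums_mult summable_sums summable_hyp1F1_1)
  moreover have "c * hyp1F1 m 1 (p * (t / (2 * b))) = shadowed_rician_density \<Omega> b m t"
    using True by (simp add: shadowed_rician_density_def q z c_def)
  moreover have "c * (pochhammer m n / (pochhammer 1 n * fact n) * (p * (t / (2 * b))) ^ n)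
      = (1 - p) powr m * (pochhammer m n / fact n * p ^ n) * erlang_density n (1 / (2 * b)) t" for n
    using True by (simp add: c_def erlang_density_def power_mult_distrib power_divide
        pochhammer_fact[symmetric] mult_ac)
  ultimately show ?thesis
    by simp
qed

lemma shadowed_rician_density_nonneg:
  assumes "\<Omega> > 0" "b > 0" "m > 0"
  shows "0 \<le> shadowed_rician_density \<Omega> b m t"
proof (cases "t = 0")
  case False
  from assms have "\<Omega> / (2 * b * m + \<Omega>) \<ge> 0"
    by simp
  with sums_le[OF _ sums_zero shadowed_rician_density_sums[OF assms False]] assms show ?thesis
    by (simp add: pochhammer_nonneg)
qed (simp add: shadowed_rician_density_def)

lemma borel_measurable_shadowed_rician_density [measurable]:
  "shadowed_rician_density \<Omega> b m \<in> borel_measurable borel"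
  unfolding shadowed_rician_density_def hyp1F1_def by measurable

text \<open>Integrates the mixture term by term; the factor (n + k)! / n! (2b)^k is the k-th moment
  of the n-th Erlang component. Working with nonnegative integrals yields integrability together
  with the value.\<close>

lemma has_bochner_integral_shadowed_rician_moment:
  fixes \<Omega> b m v :: real and k :: nat
  assumes pos: "\<Omega> > 0" "b > 0" "m > 0"
  defines "p \<equiv> \<Omega> / (2 * b * m + \<Omega>)"
  assumes v: "(\<lambda>n. (1 - p) powr m * (pochhammer m n / fact n * p ^ n)
    * (fact (n + k) / fact n * (2 * b) ^ k)) sums v"
  shows "has_bochner_integral lborel (\<lambda>t. shadowed_rician_density \<Omega> b m t * t ^ k) v"
proof -
  define w where "w n = (1 - p) powr m * (pochhammer m n / fact n * p ^ n)" for n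
  have "p \<ge> 0"
    using pos by (simp add: p_def)
  then have w: "0 \<le> w n" for n
    using pos by (simp add: w_def pochhammer_nonneg)
  have mix: "ennreal (shadowed_rician_density \<Omega> b m t * t ^ k)
      = (\<Sum>n. ennreal (w n) * ennreal (erlang_density n (1 / (2 * b)) t * t ^ k))" if "t \<noteq> 0" for t
  proof (cases "t > 0")
    case False
    then show ?thesis
      using that by (simp add: shadowed_rician_density_def erlang_density_def)
  next
    case True
    have "(\<lambda>n. w n * erlang_density n (1 / (2 * b)) t * t ^ k)
        sums (shadowed_rician_density \<Omega> b m t * t ^ k)"
      unfolding w_def p_def by (intro sums_mult2 shadowed_rician_density_sums pos that)
    then have "(\<Sum>n. ennreal (w n * erlang_density n (1 / (2 * b)) t * t ^ k))
        = ennreal (shadowed_rician_density \<Omega> b m t * t ^ k)"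
      using True w pos by (intro suminf_ennreal_eq) auto
    then show ?thesis
      using True w pos by (simp add: ennreal_mult' mult.assoc)
  qed
  have "(\<integral>\<^sup>+ t. ennreal (shadowed_rician_density \<Omega> b m t * t ^ k) \<partial>lborel)
      = (\<integral>\<^sup>+ t. (\<Sum>n. ennreal (w n) * ennreal (erlang_density n (1 / (2 * b)) t * t ^ k)) \<partial>lborel)"
    \<comment> \<open>The mixture identity is available only away from 0, a null set.\<close>
    using AE_lborel_singleton[of "0 :: real"] by (intro nn_integral_cong_AE) (auto simp: mix)
  also have "\<dots> = (\<Sum>n. ennreal (w n) *
      (\<integral>\<^sup>+ t. ennreal (erlang_density n (1 / (2 * b)) t * t ^ k) \<partial>lborel))"
    by (subst nn_integral_suminf) (auto intro!: suminf_cong nn_integral_cmult)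
  also have "\<dots> = (\<Sum>n. ennreal (w n) * ennreal (fact (n + k) / fact n * (2 * b) ^ k))"
    using pos by (subst nn_integral_erlang_ith_moment) (simp_all add: power_divide)
  also have "\<dots> = (\<Sum>n. ennreal (w n * (fact (n + k) / fact n * (2 * b) ^ k)))"
    using w by (simp only: ennreal_mult')
  also have "\<dots> = ennreal v"
    using pos w by (intro suminf_ennreal_eq v[folded w_def]) simp
  finally have nn: "(\<integral>\<^sup>+ t. ennreal (shadowed_rician_density \<Omega> b m t * t ^ k) \<partial>lborel) = ennreal v" .
  have "0 \<le> v"
    using pos w by (intro sums_le[OF _ sums_zero v[folded w_def]]) simp
  \<comment> \<open>For odd \<open>k\<close> the power is negative on the negative half-line, but
    the density is 0 there.\<close>
  moreover have "0 \<le> shadowed_rician_density \<Omega> b m t * t ^ k" for t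
  proof (cases "t > 0")
    case True
    then show ?thesis
      using shadowed_rician_density_nonneg[OF pos, of t] by simp
  qed (simp add: shadowed_rician_density_def)
  ultimately show ?thesis
    using nn by (intro has_bochner_integral_nn_integral) auto
qed

lemma (in prob_space) shadowed_rician_moments:
  fixes \<Omega> b m :: real
  assumes pos: "\<Omega> > 0" "b > 0" "m > 0"
    and D: "distributed M lborel X (shadowed_rician_density \<Omega> b m)"
  defines "\<kappa> \<equiv> (2 * b * m + \<Omega>) / (2 * b * m)"
  shows "expectation X = 2 * b * (m * \<kappa> - m + 1)"
    and "integrable M (\<lambda>x. (X x)\<^sup>2)"
    and "expectation (\<lambda>x. (X x)\<^sup>2)
      = (2 * b)\<^sup>2 * (m * (m + 1) * \<kappa>\<^sup>2 - 2 * m * (m - 1) * \<kappa> + (m - 1) * (m - 2))"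
proof -
  define p where "p = \<Omega> / (2 * b * m + \<Omega>)"
  define w where "w n = (1 - p) powr m * (pochhammer m n / fact n * p ^ n)" for n
  have bm: "2 * b * m + \<Omega> > 0"
    using pos by (simp add: add_pos_pos)
  then have p: "0 \<le> p" "p < 1" and "1 - p = 2 * b * m / (2 * b * m + \<Omega>)"
    using pos by (simp_all add: p_def field_simps)
  \<comment> \<open>Both sides equal \<Omega> / (2bm).\<close>
  then have \<kappa>: "p / (1 - p) = \<kappa> - 1"
    using bm pos by (simp add: p_def \<kappa>_def add_divide_distrib)
  note nb = negative_binomial_sums[OF p, of m, folded w_def, unfolded \<kappa>]
  have moment: "integrable M (\<lambda>x. X x ^ k) \<and> expectation (\<lambda>x. X x ^ k) = v"
    if "(\<lambda>n. w n * (fact (n + k) / fact n * (2 * b) ^ k)) sums v" for k v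
  proof -
    have "has_bochner_integral lborel (\<lambda>t. shadowed_rician_density \<Omega> b m t * t ^ k) v"
      using that unfolding w_def p_def by (rule has_bochner_integral_shadowed_rician_moment[OF pos])
    then show ?thesis
      using distributed_integral[OF D, of "\<lambda>t. t ^ k"] distributed_integrable[OF D, of "\<lambda>t. t ^ k"]
        shadowed_rician_density_nonneg[OF pos]
      by (auto simp: has_bochner_integral_iff)
  qed
  have fact_ratio: "fact (n + 1) / fact n = real (n + 1)"
    "fact (n + 2) / fact n = (real n + 2) * (real n + 1)" for n
    by (simp_all add: numeral_2_eq_2 field_simps)
  have "(\<lambda>n. (real n * w n + w n) * (2 * b)) sums ((m * (\<kappa> - 1) + 1) * (2 * b))"
    by (intro sums_mult2 sums_add nb)
  then have "(\<lambda>n. w n * (fact (n + 1) / fact n * (2 * b) ^ 1)) sums (2 * b * (m * \<kappa> - m + 1))"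
    unfolding fact_ratio by (simp add: algebra_simps)
  from moment[OF this] show "expectation X = 2 * b * (m * \<kappa> - m + 1)"
    by simp
  \<comment> \<open>The Erlang factor (n + 2)(n + 1) is n(n - 1) + 4n + 2 in falling factorials,
    matching the known factorial moments of \<open>w\<close>.\<close>
  have "(\<lambda>n. (real n * (real n - 1) * w n + 4 * (real n * w n) + 2 * w n) * (2 * b)\<^sup>2)
      sums ((m * (m + 1) * (\<kappa> - 1)\<^sup>2 + 4 * (m * (\<kappa> - 1)) + 2 * 1) * (2 * b)\<^sup>2)"
    by (intro sums_mult2 sums_mult sums_add nb)
  also have "(\<lambda>n. (real n * (real n - 1) * w n + 4 * (real n * w n) + 2 * w n) * (2 * b)\<^sup>2)
      = (\<lambda>n. w n * (fact (n + 2) / fact n * (2 * b)\<^sup>2))"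
    unfolding fact_ratio by (simp add: algebra_simps)
  also have "(m * (m + 1) * (\<kappa> - 1)\<^sup>2 + 4 * (m * (\<kappa> - 1)) + 2 * 1) * (2 * b)\<^sup>2
      = (2 * b)\<^sup>2 * (m * (m + 1) * \<kappa>\<^sup>2 - 2 * m * (m - 1) * \<kappa> + (m - 1) * (m - 2))"
    by (simp add: power2_eq_square algebra_simps)
  finally show "integrable M (\<lambda>x. (X x)\<^sup>2)" "expectation (\<lambda>x. (X x)\<^sup>2)
      = (2 * b)\<^sup>2 * (m * (m + 1) * \<kappa>\<^sup>2 - 2 * m * (m - 1) * \<kappa> + (m - 1) * (m - 2))"
    using moment by blast+
qed

section \<open>Independence of clusters and the variance of the temperature\<close>

text \<open>Functions of disjoint blocks of an independent family are independent. The separate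
  \<open>Z\<close> lets the new variables be given in their natural form, with \<open>Y\<close> only
  a witness that they depend on their block.\<close>

lemma (in prob_space) indep_vars_blocks:
  assumes "indep_vars M' X I" "\<And>j. j \<in> L \<Longrightarrow> B j \<subseteq> I" "disjoint_family_on B L"
    and "\<And>j. j \<in> L \<Longrightarrow> Y j \<in> measurable (PiM (B j) M') (N j)"
    and Z: "\<And>j x. j \<in> L \<Longrightarrow> Z j x = Y j (\<lambda>i\<in>B j. X i x)"
  shows "indep_vars N Z L"
proof -
  have "indep_vars N (\<lambda>j x. Y j (\<lambda>i\<in>B j. X i x)) L"
    using assms by (intro indep_vars_compose2[OF indep_vars_restrict])
  then show ?thesis
    using Z by (subst indep_vars_cong[OF refl, of L Z "\<lambda>j x. Y j (\<lambda>i\<in>B j. X i x)" N N]) auto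
qed

text \<open>Two uses of \<open>random_sum_moments\<close>: over the stations of one cluster, then
  over clusters with the cluster sums as summands.\<close>

lemma (in prob_space) variance_T_ml:
  fixes \<mu> s L l :: real
  assumes L: "0 < L" "poisson_distributed M K L"
    and l: "0 < l" "\<And>i. poisson_distributed M (N i) l"
    and indep: "indep_vars (\<lambda>_. borel) (rfi_rv K N H) UNIV"
    and X2: "\<And>i j. integrable M (\<lambda>x. ((cmod (H i j x))\<^sup>2)\<^sup>2)"
    and \<mu>: "\<And>i j. expectation (\<lambda>x. (cmod (H i j x))\<^sup>2) = \<mu>"
    and s: "\<And>i j. expectation (\<lambda>x. ((cmod (H i j x))\<^sup>2)\<^sup>2) = s"
  shows "variance (T_ml g \<omega> \<alpha> d K N H) = (g * \<omega> * d powr (- \<alpha>))\<^sup>2 * (L * (l * s + l\<^sup>2 * \<mu>\<^sup>2))"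
proof -
  define S where "S i x = (\<Sum>j<N i x. (cmod (H i j x))\<^sup>2)" for i x
  \<comment> \<open>Singleton blocks: this only reindexes the variables of one cluster.\<close>
  have inner: "indep_vars (\<lambda>_. borel)
      (case_option (\<lambda>x. real (N i x)) (\<lambda>j x. (cmod (H i j x))\<^sup>2)) UNIV" for i
    by (rule indep_vars_blocks[OF indep, where
          B = "case_option {BS_count i} (\<lambda>j. {Power_gain i j})" and
          Y = "case_option (\<lambda>f. f (BS_count i)) (\<lambda>j f. f (Power_gain i j))"])
      (auto simp: disjoint_family_on_def split: option.split)
  \<comment> \<open>The upper summation limit varies with \<open>f\<close> but takes countably many
    values, and for each fixed limit the sum is measurable.\<close>
  have meas: "(\<lambda>f. \<Sum>j<nat \<lfloor>f (BS_count i) :: real\<rfloor>. f (Power_gain i j))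
      \<in> borel_measurable (PiM (insert (BS_count i) (range (Power_gain i))) (\<lambda>_. borel))"
    for i :: nat
  proof (rule measurable_compose_countable[where f = "\<lambda>n f. \<Sum>j<n. f (Power_gain i j)"])
    have "(\<lambda>f. f (BS_count i))
        \<in> borel_measurable (PiM (insert (BS_count i) (range (Power_gain i))) (\<lambda>_. borel :: real measure))"
      by (rule measurable_component_singleton) simp
    then show "(\<lambda>f. nat \<lfloor>f (BS_count i) :: real\<rfloor>)
        \<in> measurable (PiM (insert (BS_count i) (range (Power_gain i))) (\<lambda>_. borel)) (count_space UNIV)"
      by (rule measurable_compose) measurable
  qed auto
  \<comment> \<open>Block \<open>i\<close> holds the station count and all gains of cluster
    \<open>i\<close>, hence determines the cluster sum.\<close>
  have outer: "indep_vars (\<lambda>_. borel) (case_option (\<lambda>x. real (K x)) S) UNIV"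
    by (rule indep_vars_blocks[OF indep, where
          B = "case_option {Cluster_count} (\<lambda>i. insert (BS_count i) (range (Power_gain i)))" and
          Y = "case_option (\<lambda>f. f Cluster_count)
            (\<lambda>i f. \<Sum>j<nat \<lfloor>f (BS_count i)\<rfloor>. f (Power_gain i j))"])
      (auto simp: disjoint_family_on_def S_def meas split: option.split)
  note S = random_sum_moments[OF inner X2 \<mu> s poisson_distributed_sums[OF l(2,1)], folded S_def]
  note U = random_sum_moments[OF outer S(2-4) poisson_distributed_sums[OF L(2,1)]]
  define c where "c = g * \<omega> * d powr (- \<alpha>)"
  have T: "T_ml g \<omega> \<alpha> d K N H = (\<lambda>x. c * (\<Sum>i<K x. S i x))"
    by (simp add: fun_eq_iff T_ml_def S_def c_def sum_distrib_left mult_ac)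
  have "variance (T_ml g \<omega> \<alpha> d K N H)
      = c\<^sup>2 * (L * (l * s + l\<^sup>2 * \<mu>\<^sup>2) + L\<^sup>2 * (l * \<mu>)\<^sup>2) - (c * (L * (l * \<mu>)))\<^sup>2"
    unfolding T using U by (subst variance_eq) (simp_all add: power_mult_distrib)
  \<comment> \<open>For a Poisson count the second factorial moment is the squared mean, so the
    mixed terms cancel the squared expectation.\<close>
  then show ?thesis
    by (simp add: c_def power_mult_distrib algebra_simps)
qed

section \<open>The two fading models\<close>

theorem corollary8:
  fixes P :: "'a measure"
    and K :: "'a \<Rightarrow> nat"
    and N :: "nat \<Rightarrow> 'a \<Rightarrow> nat"
    and H :: "nat \<Rightarrow> nat \<Rightarrow> 'a \<Rightarrow> complex"
    and \<omega> \<alpha> l_c l_BS g r\<^sub>e h :: real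
  assumes "prob_space P"
    and "\<omega> > 0" "\<alpha> > 2" "l_c > 0" "l_BS > 0" "g > 0" "r\<^sub>e > 0" "h > r\<^sub>e"
    and "poisson_distributed P K (40\<^sup>2 * l_c)"
    and "\<And>i. poisson_distributed P (N i) l_BS"
    and "prob_space.indep_vars P (\<lambda>_. borel) (rfi_rv K N H) UNIV"
  shows
    "(\<forall>b\<^sub>0. b\<^sub>0 > 0 \<longrightarrow>
        (\<forall>i j. distributed P lborel (\<lambda>x. (cmod (H i j x))\<^sup>2) (exponential_density (1 / (2 * b\<^sub>0)))) \<longrightarrow>
        prob_space.variance P (T_ml g \<omega> \<alpha> (d_ml r\<^sub>e h) K N H)
          = 40\<^sup>2 * g\<^sup>2 * \<omega>\<^sup>2 * l_c * p2_rayleigh b\<^sub>0 l_BS * d_ml r\<^sub>e h powr (- 2 * \<alpha>)) \<and>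
     (\<forall>\<Omega> b\<^sub>0 m. \<Omega> > 0 \<longrightarrow> b\<^sub>0 > 0 \<longrightarrow> m > 0 \<longrightarrow>
        (\<forall>i j. distributed P lborel (\<lambda>x. (cmod (H i j x))\<^sup>2) (shadowed_rician_density \<Omega> b\<^sub>0 m)) \<longrightarrow>
        prob_space.variance P (T_ml g \<omega> \<alpha> (d_ml r\<^sub>e h) K N H)
          = 40\<^sup>2 * g\<^sup>2 * \<omega>\<^sup>2 * l_c * p2_shadowed_rician \<Omega> b\<^sub>0 m l_BS * d_ml r\<^sub>e h powr (- 2 * \<alpha>))"
proof -
  interpret prob_space P
    by fact
  have L: "0 < 40\<^sup>2 * l_c"
    using assms by simp
  note var = variance_T_ml[OF L assms(9) \<open>l_BS > 0\<close> assms(10,11)]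
  have d2: "(d_ml r\<^sub>e h powr (- \<alpha>))\<^sup>2 = d_ml r\<^sub>e h powr (- 2 * \<alpha>)"
    by (simp add: power2_eq_square flip: powr_add)
  have rayleigh: "variance (T_ml g \<omega> \<alpha> (d_ml r\<^sub>e h) K N H)
      = 40\<^sup>2 * g\<^sup>2 * \<omega>\<^sup>2 * l_c * p2_rayleigh b\<^sub>0 l_BS * d_ml r\<^sub>e h powr (- 2 * \<alpha>)"
    if "b\<^sub>0 > 0"
      and D: "\<And>i j. distributed P lborel (\<lambda>x. (cmod (H i j x))\<^sup>2) (exponential_density (1 / (2 * b\<^sub>0)))"
    for b\<^sub>0
  proof -
    have pos: "0 < 1 / (2 * b\<^sub>0)"
      using that by simp
    \<comment> \<open>The exponential density is the Erlang density of shape 1, whose k-th moment is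
      k! times the k-th power of the mean.\<close>
    have 1: "expectation (\<lambda>x. (cmod (H i j x))\<^sup>2) = 2 * b\<^sub>0" for i j
      using erlang_ith_moment[OF pos D[of i j], of 1] by simp
    have 2: "expectation (\<lambda>x. ((cmod (H i j x))\<^sup>2)\<^sup>2) = 2 * (2 * b\<^sub>0)\<^sup>2" for i j
      using erlang_ith_moment[OF pos D[of i j], of 2] by (simp add: power_divide)
    show ?thesis
      by (subst var[OF erlang_ith_moment_integrable[OF pos D] 1 2])
        (simp add: p2_rayleigh_def power_mult_distrib d2 algebra_simps)
  qed
  have shadowed: "variance (T_ml g \<omega> \<alpha> (d_ml r\<^sub>e h) K N H)
      = 40\<^sup>2 * g\<^sup>2 * \<omega>\<^sup>2 * l_c * p2_shadowed_rician \<Omega> b\<^sub>0 m l_BS * d_ml r\<^sub>e h powr (- 2 * \<alpha>)"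
    if pos: "\<Omega> > 0" "b\<^sub>0 > 0" "m > 0"
      and D: "\<And>i j. distributed P lborel (\<lambda>x. (cmod (H i j x))\<^sup>2) (shadowed_rician_density \<Omega> b\<^sub>0 m)"
    for \<Omega> b\<^sub>0 m
  proof -
    \<comment> \<open>\<open>e\<close> stands for the path loss, \<open>A\<close> and
      \<open>B\<close> for the polynomials in \<kappa> from the first and second moments; kept
      opaque, they are not expanded by the rearrangement.\<close>
    have alg: "(g * \<omega> * e)\<^sup>2 * (40\<^sup>2 * l_c * (l_BS * ((2 * b\<^sub>0)\<^sup>2 * B) + l_BS\<^sup>2 * (2 * b\<^sub>0 * A)\<^sup>2))
        = 40\<^sup>2 * g\<^sup>2 * \<omega>\<^sup>2 * l_c * ((2 * b\<^sub>0)\<^sup>2 * (l_BS\<^sup>2 * A\<^sup>2 + l_BS * B)) * e\<^sup>2" for e A B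
      by (simp only: power_mult_distrib distrib_left distrib_right mult_ac)
    show ?thesis
      unfolding var[OF shadowed_rician_moments(2,1,3)[OF pos D]] alg d2
        p2_shadowed_rician_def Let_def ..
  qed
  show ?thesis
    using rayleigh shadowed by blast
qed

end
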